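(* There exists a function $f:\mathbb{Z}_{>0}\to\mathbb{Z}_{>0}$ with the following property. Let $n$ be a positive integer and let $G$ be a group such that $|x^G|\leq n$ for every commutator $x\in G$. Then the second derived group $G''$ is finite and $|G''|\leq f(n)$.
   Context: Groups are arbitrary (not assumed finite). For elements $x_1,x_2$ of a group, $[x_1,x_2]=x_1^{-1}x_2^{-1}x_1x_2$. An element $x\in G$ is called a commutator if $x=[x_1,x_2]$ for some $x_1,x_2\in G$ (a single commutator, not a product of several). $x^G=\{g^{-1}xg : g\in G\}$ is the conjugacy class of $x$ in $G$. $G'$ denotes the derived group of $G$ (the subgroup generated by all commutators), and $G''=(G')'$ is the second derived group. *)

theory Defs
  imports "HOL-Algebra.Generated_Groups"
begin

definition group_commutator :: "('a, 'b) monoid_scheme \<Rightarrow> 'a \<Rightarrow> 'a \<Rightarrow> 'a" where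
  "group_commutator G x y = inv\<^bsub>G\<^esub> x \<otimes>\<^bsub>G\<^esub> inv\<^bsub>G\<^esub> y \<otimes>\<^bsub>G\<^esub> x \<otimes>\<^bsub>G\<^esub> y"

definition is_commutator :: "('a, 'b) monoid_scheme \<Rightarrow> 'a \<Rightarrow> bool" where
  "is_commutator G x \<longleftrightarrow> (\<exists>x1 \<in> carrier G. \<exists>x2 \<in> carrier G. x = group_commutator G x1 x2)"

definition conj_class :: "('a, 'b) monoid_scheme \<Rightarrow> 'a \<Rightarrow> 'a set" where
  "conj_class G x = {inv\<^bsub>G\<^esub> g \<otimes>\<^bsub>G\<^esub> x \<otimes>\<^bsub>G\<^esub> g | g. g \<in> carrier G}"

text \<open>
  The library's \<^const>\<open>derived\<close> is built from the elements \<open>x y x\<^sup>-\<^sup>1 y\<^sup>-\<^sup>1\<close>. Over a subgroup these form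
  the same set as the commutators \<open>x\<^sup>-\<^sup>1 y\<^sup>-\<^sup>1 x y\<close>. For a subgroup \<open>H\<close> of \<open>G\<close>, \<open>derived G H\<close> is the
  derived group of \<open>H\<close>.
\<close>

definition second_derived :: "('a, 'b) monoid_scheme \<Rightarrow> 'a set" where
  "second_derived G = derived G (derived G (carrier G))"

text \<open>
  \<open>bounds_second_derived TYPE('a) f\<close>: the function \<open>f\<close> has the required property for all groups whose
  elements are taken from the type \<open>'a\<close>. Finiteness is required explicitly because \<^const>\<open>card\<close> of an
  infinite set is 0.
\<close>

definition bounds_second_derived :: "'a itself \<Rightarrow> (nat \<Rightarrow> nat) \<Rightarrow> bool" where
  "bounds_second_derived _ f \<longleftrightarrow>
     (\<forall>n > 0. \<forall>G :: 'a monoid.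
        group G \<longrightarrow>
        (\<forall>x. is_commutator G x \<longrightarrow> finite (conj_class G x) \<and> card (conj_class G x) \<le> n) \<longrightarrow>
        finite (second_derived G) \<and> card (second_derived G) \<le> f n)"

text \<open>
  One function \<open>f\<close> has to serve groups over all types, but a formula \<open>\<exists>f. bounds_second_derived TYPE('a) f\<close>
  would let \<open>f\<close> vary with \<open>'a\<close>, and HOL cannot quantify over types under the \<open>\<exists>\<close>. Uniformity is
  expressed by asking for an \<open>f\<close> for the closed type \<^typ>\<open>nat\<close>, so that \<open>f\<close> does not mention \<open>'a\<close>, and
  by asserting that every such \<open>f\<close> also works over an arbitrary type \<open>'a\<close>.
\<close>

end

theory Submission
  imports Defs "HOL-Algebra.SndIsomorphismGrp" "HOL-Library.Countable_Set"
begin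

text \<open>
  Write \<open>H = G'\<close>, and for a normal subgroup \<open>N\<close> let \<open>Z(N)\<close> be the preimage of the centralizer of
  \<open>H N / N\<close> in \<open>G / N\<close>. It suffices to find a normal \<open>N\<close> of bounded order such that \<open>Z(N)\<close> contains
  all commutators, for then \<open>H \<subseteq> Z(N)\<close> and \<open>G'' \<subseteq> N\<close>.

  For a commutator \<open>a\<close>, the elements \<open>[h, y]\<close> with \<open>h \<in> H\<close> and \<open>y \<in> a\<^sup>G\<close> form a conjugation-invariant set
  of at most \<open>n\<^sup>2\<close> elements, and it generates a group of bounded order by the shortening argument
  that proves Schur's theorem. So \<open>a\<close> lies in \<open>Z(N)\<close> for a bounded \<open>N\<close>.

  Let \<open>D\<close> be a set of commutators and choose \<open>a \<in> D\<close> with \<open>|a\<^sup>H|\<close> maximal. The class \<open>a\<^sup>H\<close> is attained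
  by conjugation with few elements \<open>b\<close>, each a product of at most \<open>n\<close> commutators. If \<open>x = u a \<in> D\<close>
  and \<open>u\<close> centralizes these \<open>b\<close>, then \<open>u a\<^sup>H \<subseteq> x\<^sup>H\<close>, so equality holds by maximality, and
  \<open>[h, x] = [k, a]\<close> for a suitable \<open>k \<in> H\<close>; thus \<open>x \<in> Z(N)\<close> for the \<open>N\<close> belonging to \<open>a\<close>. With \<open>D\<close> the set of all
  commutators this yields a subgroup \<open>U\<close> of bounded index with \<open>[U, U] \<subseteq> Z(N)\<close>, and with
  \<open>D = {[d, e] | e \<in> G}\<close>, where \<open>d\<close> runs over a transversal of \<open>U\<close>, a subgroup \<open>V\<close> of bounded index with
  \<open>[G, V] \<subseteq> Z(N)\<close>. It remains to absorb the commutators of a transversal of \<open>V\<close>.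

  The bound carries over from \<^typ>\<open>nat\<close> to any type because finitely many elements of \<open>G''\<close> already
  lie in the second derived group of a finitely generated, hence countable, subgroup of \<open>G\<close>.
\<close>

subsection \<open>Conjugation, commutators and words\<close>

context group
begin

lemma inv_cancel_left: "x \<in> carrier G \<Longrightarrow> y \<in> carrier G \<Longrightarrow> inv x \<otimes> (x \<otimes> y) = y"
  by (simp flip: m_assoc)

lemma inv_cancel_left': "x \<in> carrier G \<Longrightarrow> y \<in> carrier G \<Longrightarrow> x \<otimes> (inv x \<otimes> y) = y"
  by (simp flip: m_assoc)

lemmas cancel_simps = m_assoc inv_mult_group inv_cancel_left inv_cancel_left'

definition conj_by :: "'a \<Rightarrow> 'a \<Rightarrow> 'a" where
  "conj_by g x = inv g \<otimes> x \<otimes> g"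

abbreviation comm :: "'a \<Rightarrow> 'a \<Rightarrow> 'a" where
  "comm \<equiv> group_commutator G"

lemma conj_by_closed [simp, intro]:
  "g \<in> carrier G \<Longrightarrow> x \<in> carrier G \<Longrightarrow> conj_by g x \<in> carrier G"
  by (simp add: conj_by_def)

lemma comm_closed [simp, intro]: "x \<in> carrier G \<Longrightarrow> y \<in> carrier G \<Longrightarrow> comm x y \<in> carrier G"
  by (simp add: group_commutator_def)

lemma conj_by_one [simp]: "x \<in> carrier G \<Longrightarrow> conj_by \<one> x = x"
  by (simp add: conj_by_def)

lemma conj_by_mult:
  "g \<in> carrier G \<Longrightarrow> h \<in> carrier G \<Longrightarrow> x \<in> carrier G
    \<Longrightarrow> conj_by (g \<otimes> h) x = conj_by h (conj_by g x)"
  by (simp add: conj_by_def cancel_simps)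

lemma conj_by_prod:
  "g \<in> carrier G \<Longrightarrow> x \<in> carrier G \<Longrightarrow> y \<in> carrier G
    \<Longrightarrow> conj_by g (x \<otimes> y) = conj_by g x \<otimes> conj_by g y"
  by (simp add: conj_by_def cancel_simps)

lemma conj_by_inv:
  "g \<in> carrier G \<Longrightarrow> x \<in> carrier G \<Longrightarrow> conj_by g (inv x) = inv (conj_by g x)"
  by (simp add: conj_by_def cancel_simps)

lemma conj_by_comm:
  "g \<in> carrier G \<Longrightarrow> x \<in> carrier G \<Longrightarrow> y \<in> carrier G
    \<Longrightarrow> conj_by g (comm x y) = comm (conj_by g x) (conj_by g y)"
  by (simp add: conj_by_def group_commutator_def cancel_simps)

lemma conj_by_inv_cancel [simp]:
  "g \<in> carrier G \<Longrightarrow> x \<in> carrier G \<Longrightarrow> conj_by g (conj_by (inv g) x) = x"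
  "g \<in> carrier G \<Longrightarrow> x \<in> carrier G \<Longrightarrow> conj_by (inv g) (conj_by g x) = x"
  by (simp_all add: conj_by_def cancel_simps)

lemma conj_by_inject:
  "g \<in> carrier G \<Longrightarrow> x \<in> carrier G \<Longrightarrow> y \<in> carrier G
    \<Longrightarrow> conj_by g x = conj_by g y \<longleftrightarrow> x = y"
  by (metis conj_by_inv_cancel(2))

lemma conj_by_eq_self_iff:
  "g \<in> carrier G \<Longrightarrow> x \<in> carrier G \<Longrightarrow> conj_by g x = x \<longleftrightarrow> x \<otimes> g = g \<otimes> x"
  by (metis conj_by_def inv_closed inv_solve_left m_assoc m_closed)

lemma comm_eq: "x \<in> carrier G \<Longrightarrow> y \<in> carrier G \<Longrightarrow> comm x y = inv (conj_by x y) \<otimes> y"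
  by (simp add: conj_by_def group_commutator_def cancel_simps)

lemma comm_inv: "x \<in> carrier G \<Longrightarrow> y \<in> carrier G \<Longrightarrow> inv (comm x y) = comm y x"
  by (simp add: group_commutator_def cancel_simps)

lemma comm_mult_left:
  "x \<in> carrier G \<Longrightarrow> y \<in> carrier G \<Longrightarrow> z \<in> carrier G
    \<Longrightarrow> comm (x \<otimes> y) z = conj_by y (comm x z) \<otimes> comm y z"
  by (simp add: conj_by_def group_commutator_def cancel_simps)

lemma comm_mult_right:
  "x \<in> carrier G \<Longrightarrow> y \<in> carrier G \<Longrightarrow> z \<in> carrier G
    \<Longrightarrow> comm x (y \<otimes> z) = comm x z \<otimes> conj_by z (comm x y)"
  by (simp add: conj_by_def group_commutator_def cancel_simps)

lemma conj_class_eq: "conj_class G x = (\<lambda>g. conj_by g x) ` carrier G"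
  by (auto simp: conj_class_def conj_by_def)

lemma conj_class_closed: "x \<in> carrier G \<Longrightarrow> conj_class G x \<subseteq> carrier G"
  by (auto simp: conj_class_eq)

definition conj_closed :: "'a set \<Rightarrow> bool" where
  "conj_closed S \<longleftrightarrow> S \<subseteq> carrier G \<and> (\<forall>g\<in>carrier G. \<forall>s\<in>S. conj_by g s \<in> S)"

lemma conj_closed_conj_class: "x \<in> carrier G \<Longrightarrow> conj_closed (conj_class G x)"
  by (auto simp: conj_closed_def conj_class_eq simp flip: conj_by_mult)

lemma conj_closed_Union: "(\<And>S. S \<in> \<S> \<Longrightarrow> conj_closed S) \<Longrightarrow> conj_closed (\<Union>\<S>)"
  by (auto simp: conj_closed_def) blast

lemma normal_conj_by: "N \<lhd> G \<Longrightarrow> g \<in> carrier G \<Longrightarrow> x \<in> N \<Longrightarrow> conj_by g x \<in> N"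
  using normal.inv_op_closed1[of N G g x] by (simp add: conj_by_def)

definition word :: "'a list \<Rightarrow> 'a" where
  "word ws = foldr (\<otimes>) ws \<one>"

lemma word_simps [simp]: "word [] = \<one>" "word (x # xs) = x \<otimes> word xs"
  by (simp_all add: word_def)

lemma word_closed [simp, intro]: "set ws \<subseteq> carrier G \<Longrightarrow> word ws \<in> carrier G"
  by (induction ws) auto

lemma word_append:
  "set xs \<subseteq> carrier G \<Longrightarrow> set ys \<subseteq> carrier G \<Longrightarrow> word (xs @ ys) = word xs \<otimes> word ys"
  by (induction xs) (auto simp: m_assoc)

lemma word_replicate: "s \<in> carrier G \<Longrightarrow> word (replicate k s) = s [^] k"
  by (induction k) (simp_all, metis nat_pow_Suc nat_pow_Suc2)

lemma word_map_conj_by: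
  "g \<in> carrier G \<Longrightarrow> set xs \<subseteq> carrier G \<Longrightarrow> word (map (conj_by g) xs) = conj_by g (word xs)"
  by (induction xs) (auto simp: conj_by_prod, simp add: conj_by_def)

lemma generate_subset_words:
  assumes "S \<subseteq> carrier G" "\<And>s. s \<in> S \<Longrightarrow> inv s \<in> S"
  shows "generate G S \<subseteq> word ` lists S"
proof
  fix x assume "x \<in> generate G S"
  then have "\<exists>ws. set ws \<subseteq> S \<and> x = word ws"
  proof (induction rule: generate.induct)
    case one
    show ?case by (intro exI[of _ "[]"]) simp
  next
    case (incl h)
    then show ?case using assms by (intro exI[of _ "[h]"]) auto
  next
    case (inv h)
    then show ?case using assms by (intro exI[of _ "[inv h]"]) auto
  next
    case (eng x y)
    then obtain xs ys where "set xs \<subseteq> S" "x = word xs" "set ys \<subseteq> S" "y = word ys" by blast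
    then show ?case using assms(1) by (intro exI[of _ "xs @ ys"]) (auto simp: word_append)
  qed
  then show "x \<in> word ` lists S" by auto
qed

lemma derived_eq_generate_comm:
  assumes "subgroup H G"
  shows "derived G H = generate G {comm x y |x y. x \<in> H \<and> y \<in> H}"
proof -
  have *: "inv x \<in> H \<and> x \<in> carrier G" if "x \<in> H" for x
    using assms that subgroup.m_inv_closed subgroup.mem_carrier by metis
  have "derived_set G H = {comm x y |x y. x \<in> H \<and> y \<in> H}"
  proof (intro subset_antisym subsetI)
    fix z assume "z \<in> derived_set G H"
    then obtain x y where "x \<in> H" "y \<in> H" "z = x \<otimes> y \<otimes> inv x \<otimes> inv y" by auto
    then have "z = comm (inv x) (inv y)" "inv x \<in> H" "inv y \<in> H"
      using * by (auto simp: group_commutator_def)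
    then show "z \<in> {comm x y |x y. x \<in> H \<and> y \<in> H}" by blast
  next
    fix z assume "z \<in> {comm x y |x y. x \<in> H \<and> y \<in> H}"
    then obtain x y where xy: "x \<in> H" "y \<in> H" "z = comm x y" by auto
    then have "z = inv x \<otimes> inv y \<otimes> inv (inv x) \<otimes> inv (inv y)" "inv x \<in> H" "inv y \<in> H"
      using * by (auto simp: group_commutator_def)
    then show "z \<in> derived_set G H" by blast
  qed
  then show ?thesis by (simp add: derived_def)
qed

lemma derived_subset_iff:
  assumes "subgroup H G" "subgroup N G"
  shows "derived G H \<subseteq> N \<longleftrightarrow> (\<forall>x\<in>H. \<forall>y\<in>H. comm x y \<in> N)"
proof
  assume "derived G H \<subseteq> N"
  then show "\<forall>x\<in>H. \<forall>y\<in>H. comm x y \<in> N"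
    unfolding derived_eq_generate_comm[OF assms(1)] by (blast intro: generate.incl)
next
  assume "\<forall>x\<in>H. \<forall>y\<in>H. comm x y \<in> N"
  then show "derived G H \<subseteq> N"
    unfolding derived_eq_generate_comm[OF assms(1)]
    by (intro generate_subgroup_incl assms) auto
qed

text \<open>If a conjugating word is longer than the conjugacy class, two of its prefixes conjugate \<open>y\<close> to
  the same element, and the segment between them can be deleted.\<close>

lemma ex_short_conjugating_word:
  assumes X: "X \<subseteq> carrier G" and y: "y \<in> carrier G"
    and fin: "finite (conj_class G y)" and card: "card (conj_class G y) \<le> n"
    and us: "set us \<subseteq> X"
  shows "\<exists>ws. set ws \<subseteq> X \<and> length ws \<le> n \<and> conj_by (word ws) y = conj_by (word us) y"
  using us
proof (induction "length us" arbitrary: us rule: less_induct)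
  case less
  show ?case
  proof (cases "length us \<le> n")
    case True
    with less.prems show ?thesis by blast
  next
    case False
    define p where "p i = conj_by (word (take i us)) y" for i
    have c: "set (take i us) \<subseteq> carrier G" "set (drop i us) \<subseteq> carrier G" for i
      using less.prems X set_take_subset set_drop_subset by (metis subset_trans)+
    have "p ` {..length us} \<subseteq> conj_class G y"
      using c by (auto simp: conj_class_eq p_def)
    then have "card (p ` {..length us}) \<le> n"
      using card card_mono[OF fin] by (meson order_trans)
    then have "\<not> inj_on p {..length us}"
      using False by (intro pigeonhole) simp
    then obtain i j where ij: "i < j" "j \<le> length us" "p i = p j"
      unfolding inj_on_def by (metis atMost_iff linorder_neqE_nat)
    define vs where "vs = take i us @ drop j us"
    have "conj_by (word vs) y = conj_by (word (drop j us)) (p i)"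
      using c y by (simp add: vs_def p_def word_append conj_by_mult)
    also have "\<dots> = conj_by (word (take j us @ drop j us)) y"
      unfolding ij(3) using c y by (subst word_append) (simp_all add: p_def conj_by_mult)
    finally have "conj_by (word vs) y = conj_by (word us) y" by simp
    moreover have "set vs \<subseteq> X"
      unfolding vs_def using less.prems by (auto dest: in_set_takeD in_set_dropD)
    moreover have "length vs < length us" using ij by (simp add: vs_def)
    ultimately show ?thesis using less.hyps[of vs] by auto
  qed
qed

text \<open>Conjugation on a finite conjugation-invariant set \<open>S\<close> is a function from \<open>S\<close> to itself, and
  there are at most \<open>|S| ^ |S|\<close> of these.\<close>

lemma finite_conj_actions:
  assumes "finite S" "conj_closed S"
  shows "finite ((\<lambda>g. restrict (conj_by g) S) ` carrier G)"
    and "card ((\<lambda>g. restrict (conj_by g) S) ` carrier G) \<le> card S ^ card S"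
proof -
  have sub: "(\<lambda>g. restrict (conj_by g) S) ` carrier G \<subseteq> S \<rightarrow>\<^sub>E S"
    using assms(2) by (auto simp: conj_closed_def)
  have fin: "finite (S \<rightarrow>\<^sub>E S)" using assms(1) by (simp add: finite_PiE)
  show "finite ((\<lambda>g. restrict (conj_by g) S) ` carrier G)"
    using sub fin finite_subset by blast
  show "card ((\<lambda>g. restrict (conj_by g) S) ` carrier G) \<le> card S ^ card S"
    using card_mono[OF fin sub] by (simp add: card_funcsetE assms(1))
qed

lemma restrict_conj_by_eq_iff:
  "restrict (conj_by g) S = restrict (conj_by h) S \<longleftrightarrow> (\<forall>s\<in>S. conj_by g s = conj_by h s)"
  by (metis restrict_apply' restrict_ext)

lemma ex_conj_action_transversal:
  assumes "finite S" "conj_closed S"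
  shows "\<exists>R. R \<subseteq> carrier G \<and> finite R \<and> card R \<le> card S ^ card S \<and>
    (\<forall>g\<in>carrier G. \<exists>r\<in>R. \<forall>s\<in>S. conj_by g s = conj_by r s)"
proof -
  define F where "F = (\<lambda>g. restrict (conj_by g) S)"
  obtain R where R: "R \<subseteq> carrier G" "inj_on F R" "F ` R = F ` carrier G"
    by (metis subset_image_inj order_refl)
  have fin: "finite (F ` R)" "card (F ` R) \<le> card S ^ card S"
    using finite_conj_actions[OF assms] R(3) by (auto simp: F_def)
  have "\<exists>r\<in>R. \<forall>s\<in>S. conj_by g s = conj_by r s" if "g \<in> carrier G" for g
  proof -
    have "F g \<in> F ` R" using R(3) that by blast
    then show ?thesis by (auto simp: F_def restrict_conj_by_eq_iff)
  qed
  then show ?thesis using R fin finite_imageD[OF fin(1) R(2)] card_image[OF R(2)] by auto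
qed

text \<open>Pigeonhole: the exponents \<open>0..K\<close> give \<open>K + 1\<close> powers of
  \<open>g\<close> but at most \<open>K\<close> maps on \<open>S\<close>. Two powers agree on
  \<open>S\<close>, and the power with the difference of their exponents acts trivially.\<close>

lemma ex_pow_centralizing:
  assumes "finite S" "conj_closed S" and g: "g \<in> carrier G"
  shows "\<exists>k. 0 < k \<and> k \<le> card S ^ card S \<and> (\<forall>s\<in>S. conj_by (g [^] k) s = s)"
proof -
  define K where "K = card S ^ card S"
  define p where "p i = restrict (conj_by (g [^] i)) S" for i :: nat
  have "p ` {..K} \<subseteq> (\<lambda>g. restrict (conj_by g) S) ` carrier G"
    using g by (auto simp: p_def)
  then have "card (p ` {..K}) \<le> K"
    using card_mono[OF finite_conj_actions(1)[OF assms(1,2)]] finite_conj_actions(2)[OF assms(1,2)]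
    unfolding K_def by (meson order_trans)
  then have "\<not> inj_on p {..K}" by (intro pigeonhole) simp
  then obtain i j where ij: "i < j" "j \<le> K" "p i = p j"
    unfolding inj_on_def by (metis atMost_iff linorder_neqE_nat)
  have "conj_by (g [^] (j - i)) s = s" if s: "s \<in> S" for s
  proof -
    have sc: "s \<in> carrier G" using s assms(2) by (auto simp: conj_closed_def)
    have "g [^] j = g [^] (j - i) \<otimes> g [^] i" using ij g by (simp add: nat_pow_mult)
    then have "conj_by (g [^] i) (conj_by (g [^] (j - i)) s) = conj_by (g [^] j) s"
      using g sc by (simp add: conj_by_mult)
    also have "\<dots> = conj_by (g [^] i) s"
      using ij(3) s by (simp add: p_def restrict_conj_by_eq_iff)
    finally show ?thesis using g sc by (simp add: conj_by_inject)
  qed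
  then show ?thesis using ij unfolding K_def by (intro exI[of _ "j - i"]) auto
qed

subsection \<open>Shortening words over a conjugation-invariant set\<close>

lemma conj_by_pow:
  "g \<in> carrier G \<Longrightarrow> x \<in> carrier G \<Longrightarrow> conj_by g (x [^] (k::nat)) = conj_by g x [^] k"
  by (induction k) (simp_all add: conj_by_prod, simp add: conj_by_def)

text \<open>Moving an occurrence of \<open>s\<close> to the front conjugates the letters it passes by \<open>s\<close>.\<close>

lemma word_collect:
  assumes S: "conj_closed S" and s: "s \<in> S"
  shows "set ws \<subseteq> S \<Longrightarrow> k \<le> count_list ws s \<Longrightarrow>
    \<exists>us. set us \<subseteq> S \<and> length us + k = length ws \<and> word ws = s [^] k \<otimes> word us"
proof (induction k arbitrary: ws)
  case 0
  have "word ws \<in> carrier G" using 0 S by (intro word_closed) (auto simp: conj_closed_def)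
  then show ?case using 0 by (intro exI[of _ ws]) auto
next
  case (Suc k)
  have sc: "s \<in> carrier G" using S s by (auto simp: conj_closed_def)
  have "s \<in> set ws" using Suc.prems(2) by (metis count_list_0_iff not_less_eq_eq zero_le)
  then obtain xs ys where ws: "ws = xs @ s # ys" "s \<notin> set xs" by (meson split_list_first)
  define vs where "vs = map (conj_by s) xs @ ys"
  have c: "set xs \<subseteq> carrier G" "set ys \<subseteq> carrier G"
    using Suc.prems(1) S ws(1) by (auto simp: conj_closed_def)
  have "word ws = s \<otimes> word vs"
    using c sc unfolding ws(1) vs_def
    by (subst (1 2) word_append) (auto simp: word_map_conj_by conj_by_def cancel_simps)
  moreover have "set vs \<subseteq> S"
    using Suc.prems(1) S sc ws(1) by (auto simp: conj_closed_def vs_def)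
  moreover have "k \<le> count_list vs s"
    using Suc.prems(2) ws by (auto simp: vs_def)
  ultimately obtain us where us: "set us \<subseteq> S" "length us + k = length vs"
    "word ws = s \<otimes> (s [^] k \<otimes> word us)"
    using Suc.IH[of vs] by auto
  have "word us \<in> carrier G" using us(1) S by (intro word_closed) (auto simp: conj_closed_def)
  then have "word ws = s [^] Suc k \<otimes> word us"
    using us(3) sc by (metis m_assoc nat_pow_Suc2 nat_pow_closed)
  then show ?case using us ws(1) by (intro exI[of _ us]) (auto simp: vs_def)
qed

text \<open>A word of length greater than \<open>|S| K\<close> contains more than \<open>K\<close> copies of some \<open>s\<close>; collected in front,
  they form a power of \<open>s\<close> that can be shortened.\<close>

lemma ex_short_word:
  assumes S: "conj_closed S" "finite S"
    and short: "\<And>s. s \<in> S \<Longrightarrow> \<exists>zs. set zs \<subseteq> S \<and> length zs \<le> K \<and> s [^] Suc (length zs) = word zs"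
    and ws: "set ws \<subseteq> S"
  shows "\<exists>vs. set vs \<subseteq> S \<and> length vs \<le> card S * K \<and> word vs = word ws"
  using ws
proof (induction "length ws" arbitrary: ws rule: less_induct)
  case less
  show ?case
  proof (cases "length ws \<le> card S * K")
    case True
    with less.prems show ?thesis by blast
  next
    case False
    have "\<exists>s\<in>S. K < count_list ws s"
    proof (rule ccontr)
      assume "\<not> ?thesis"
      then have "(\<Sum>s\<in>S. count_list ws s) \<le> of_nat (card S) * K"
        by (intro sum_bounded_above) (auto simp: not_less)
      then show False using False sum_count_set[OF less.prems S(2)] by simp
    qed
    then obtain s where s: "s \<in> S" "K < count_list ws s" by blast
    obtain zs where zs: "set zs \<subseteq> S" "length zs \<le> K" "s [^] Suc (length zs) = word zs"
      using short[OF s(1)] by blast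
    obtain us where us: "set us \<subseteq> S" "length us + Suc (length zs) = length ws"
      "word ws = s [^] Suc (length zs) \<otimes> word us"
      using word_collect[OF S(1) s(1) less.prems, of "Suc (length zs)"] s(2) zs(2) by auto
    \<comment> \<open>One letter is saved: \<open>zs\<close> replaces \<open>Suc (length zs)\<close>
      copies of \<open>s\<close>.\<close>
    have "word ws = word (zs @ us)"
      using us zs S(1) by (subst word_append) (auto simp: conj_closed_def)
    then show ?thesis using less.hyps[of "zs @ us"] us zs by auto
  qed
qed

text \<open>Put \<open>s = [h, y] = h^-1 g\<close> with \<open>g = y^-1 h y\<close>. Since
  \<open>s^(k+1)\<close> commutes with \<open>g\<close>,
  \<open>s^(k+2) = h^-1 g s^(k+1) = h^-1 s^(k+1) g = h^-2 g s^k g\<close>. This is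
  \<open>h^-2 g^2 = [h^2, y]\<close> times the conjugate of \<open>s^k\<close> by \<open>g\<close>,
  so \<open>k + 2\<close> factors become \<open>k + 1\<close>.\<close>

lemma comm_pow_eq:
  fixes k :: nat
  assumes c: "h \<in> carrier G" "y \<in> carrier G"
    and fixed: "conj_by (comm h y [^] Suc k) h = h" "conj_by (comm h y [^] Suc k) y = y"
  shows "comm h y [^] Suc (Suc k) =
    comm (h \<otimes> h) y \<otimes> conj_by (inv y \<otimes> h \<otimes> y) (comm h y) [^] k"
proof -
  define s where "s = comm h y"
  define g where "g = inv y \<otimes> h \<otimes> y"
  have cl: "s \<in> carrier G" "g \<in> carrier G" using c by (simp_all add: s_def g_def)
  have s: "s = inv h \<otimes> g" using c by (simp add: s_def g_def group_commutator_def cancel_simps)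
  have "conj_by (s [^] Suc k) g = g"
    using c cl fixed by (simp add: g_def s_def conj_by_prod conj_by_inv del: nat_pow_Suc)
  then have gq: "g \<otimes> s [^] Suc k = s [^] Suc k \<otimes> g"
    using cl by (simp add: conj_by_eq_self_iff del: nat_pow_Suc)
  have "s [^] Suc (Suc k) = s \<otimes> s [^] Suc k" by (rule nat_pow_Suc2[OF cl(1)])
  also have "\<dots> = inv h \<otimes> (g \<otimes> s [^] Suc k)"
    using c cl s by (simp add: m_assoc del: nat_pow_Suc)
  also have "\<dots> = inv h \<otimes> (s \<otimes> s [^] k \<otimes> g)"
    by (simp only: gq) (simp only: nat_pow_Suc2[OF cl(1)])
  also have "\<dots> = comm (h \<otimes> h) y \<otimes> conj_by g (s [^] k)"
    unfolding s_def g_def using c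
    by (simp add: group_commutator_def conj_by_def cancel_simps)
  finally show ?thesis
    using cl unfolding conj_by_pow[OF cl(2,1)] by (simp add: s_def g_def del: nat_pow_Suc)
qed

text \<open>By \<open>ex_short_word\<close>, words of length at most \<open>card S * K\<close>
  already cover the generated group. Their number is then estimated with \<open>m\<close> letters,
  so that the bound depends on \<open>m\<close> and \<open>K\<close> alone.\<close>

lemma card_generate_le:
  assumes S: "conj_closed S" "finite S" and inv: "\<And>s. s \<in> S \<Longrightarrow> inv s \<in> S"
    and short: "\<And>s. s \<in> S \<Longrightarrow> \<exists>zs. set zs \<subseteq> S \<and> length zs \<le> K \<and> s [^] Suc (length zs) = word zs"
    and m: "card S \<le> m"
  shows "finite (generate G S)" "card (generate G S) \<le> (\<Sum>i\<le>m * K. m ^ i)"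
proof -
  define L where "L = {ws. set ws \<subseteq> S \<and> length ws \<le> card S * K}"
  have L: "finite L" "card L = (\<Sum>i\<le>card S * K. card S ^ i)"
    unfolding L_def using S(2) by (simp_all add: finite_lists_length_le card_lists_length_le)
  have "word ` lists S \<subseteq> word ` L"
  proof
    fix x assume "x \<in> word ` lists S"
    then obtain ws where "set ws \<subseteq> S" "x = word ws" by auto
    then obtain vs where "vs \<in> L" "word vs = x"
      using ex_short_word[OF S short] unfolding L_def by blast
    then show "x \<in> word ` L" by blast
  qed
  then have sub: "generate G S \<subseteq> word ` L"
    using generate_subset_words[of S] S(1) inv by (auto simp: conj_closed_def)
  then show "finite (generate G S)" using L(1) finite_surj by blast
  have "card (generate G S) \<le> card L" using sub L(1) by (rule surj_card_le[rotated])
  also have "\<dots> \<le> (\<Sum>i\<le>card S * K. m ^ i)"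
    unfolding L(2) using m by (intro sum_mono power_mono) auto
  also have "\<dots> \<le> (\<Sum>i\<le>m * K. m ^ i)"
    using m by (intro sum_mono2) auto
  finally show "card (generate G S) \<le> (\<Sum>i\<le>m * K. m ^ i)" .
qed

lemma conj_by_word_fixed:
  assumes "g \<in> carrier G" "set us \<subseteq> carrier G" "\<And>u. u \<in> set us \<Longrightarrow> conj_by g u = u"
  shows "conj_by g (word us) = word us"
  using word_map_conj_by[OF assms(1,2)] map_idI[of us "conj_by g"] assms(3) by simp

end

lemma self_power_mono:
  fixes m k :: nat
  assumes "m \<le> k"
  shows "m ^ m \<le> k ^ k"
proof (cases "k = 0")
  case False
  have "m ^ m \<le> k ^ m" using assms by (intro power_mono) auto
  also have "\<dots> \<le> k ^ k" using assms False by (intro power_increasing) auto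
  finally show ?thesis .
qed (use assms in auto)

text \<open>The number of words of length at most \<open>M K\<close> over an alphabet of size \<open>M = n\<^sup>2\<close>, where \<open>K = k ^ k\<close>
  bounds the number of permutations that conjugation induces on a set of \<open>k = n\<^sup>2 + n\<close> elements.\<close>

definition order_bound :: "nat \<Rightarrow> nat" where
  "order_bound n = (\<Sum>i\<le>n * n * (n * n + n) ^ (n * n + n). (n * n) ^ i)"

subsection \<open>Groups with bounded conjugacy classes of commutators\<close>

locale bounded_commutator_classes = group G for G (structure) +
  fixes n :: nat
  assumes finite_conj_class: "is_commutator G x \<Longrightarrow> finite (conj_class G x)"
    and card_conj_class: "is_commutator G x \<Longrightarrow> card (conj_class G x) \<le> n"
begin

abbreviation commutators :: "'a set" where
  "commutators \<equiv> {x. is_commutator G x}"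

abbreviation H :: "'a set" where
  "H \<equiv> derived G (carrier G)"

lemma commutators_eq: "commutators = {comm x y |x y. x \<in> carrier G \<and> y \<in> carrier G}"
  by (auto simp: is_commutator_def)

lemma commutators_closed: "commutators \<subseteq> carrier G"
  by (auto simp: commutators_eq)

lemma is_commutator_carrier: "is_commutator G x \<Longrightarrow> x \<in> carrier G"
  using commutators_closed by auto

lemma is_commutator_comm: "x \<in> carrier G \<Longrightarrow> y \<in> carrier G \<Longrightarrow> is_commutator G (comm x y)"
  by (auto simp: is_commutator_def)

lemma is_commutator_conj_by:
  "is_commutator G x \<Longrightarrow> g \<in> carrier G \<Longrightarrow> is_commutator G (conj_by g x)"
  by (auto simp: is_commutator_def) (metis conj_by_comm conj_by_closed)

lemma is_commutator_conj_class:
  "is_commutator G x \<Longrightarrow> y \<in> conj_class G x \<Longrightarrow> is_commutator G y"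
  by (auto simp: conj_class_eq is_commutator_conj_by)

lemma H_normal: "H \<lhd> G"
  by (rule derived_self_is_normal)

lemma H_subgroup: "subgroup H G"
  by (rule normal_imp_subgroup[OF H_normal])

lemma H_carrier: "x \<in> H \<Longrightarrow> x \<in> carrier G"
  by (rule subgroup.mem_carrier[OF H_subgroup])

lemma H_eq: "H = generate G commutators"
  unfolding derived_eq_generate_comm[OF subgroup_self] commutators_eq ..

text \<open>No inverse letters are needed, because \<open>[x, y]^-1 = [y, x]\<close>.\<close>

lemma H_subset_words: "H \<subseteq> word ` lists commutators"
  unfolding H_eq
proof (rule generate_subset_words[OF commutators_closed])
  show "inv s \<in> commutators" if "s \<in> commutators" for s
    using that comm_inv unfolding commutators_eq by blast
qed

lemma word_in_H: "set ws \<subseteq> commutators \<Longrightarrow> word ws \<in> H"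
  using subgroup.one_closed[OF H_subgroup] subgroup.m_closed[OF H_subgroup]
  by (induction ws) (auto simp: H_eq intro: generate.incl)

lemma ex_short_word_conj:
  assumes "h \<in> H" "is_commutator G y"
  shows "\<exists>ws. set ws \<subseteq> commutators \<and> length ws \<le> n \<and> conj_by (word ws) y = conj_by h y"
proof -
  obtain us where "set us \<subseteq> commutators" "h = word us"
    using subsetD[OF H_subset_words assms(1)] by (auto simp: lists_eq_set)
  then show ?thesis
    using ex_short_conjugating_word[OF commutators_closed is_commutator_carrier[OF assms(2)]
        finite_conj_class[OF assms(2)] card_conj_class[OF assms(2)]] by blast
qed

lemma conj_closed_UN:
  assumes "\<And>i. i \<in> I \<Longrightarrow> is_commutator G (f i)"
  shows "conj_closed (\<Union>i\<in>I. conj_class G (f i))"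
  using assms by (intro conj_closed_Union) (auto intro!: conj_closed_conj_class is_commutator_carrier)

lemma card_UN_conj_class:
  assumes "finite I" "\<And>i. i \<in> I \<Longrightarrow> is_commutator G (f i)"
  shows "finite (\<Union>i\<in>I. conj_class G (f i))" "card (\<Union>i\<in>I. conj_class G (f i)) \<le> card I * n"
proof -
  show "finite (\<Union>i\<in>I. conj_class G (f i))" using assms finite_conj_class by blast
  have "card (\<Union>i\<in>I. conj_class G (f i)) \<le> (\<Sum>i\<in>I. card (conj_class G (f i)))"
    using assms(1) by (rule card_UN_le)
  also have "\<dots> \<le> of_nat (card I) * n"
    using assms card_conj_class by (intro sum_bounded_above) auto
  finally show "card (\<Union>i\<in>I. conj_class G (f i)) \<le> card I * n" by simp
qed

lemma self_in_conj_class: "x \<in> carrier G \<Longrightarrow> x \<in> conj_class G x"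
  unfolding conj_class_eq by (rule image_eqI[of _ _ \<one>]) auto

text \<open>Replacing \<open>h\<close> by a short word with the same effect on \<open>y\<close> makes the centralizers of \<open>h\<close> and \<open>y\<close> of
  bounded index, so a bounded power of \<open>[h, y]\<close> commutes with both.\<close>

lemma comm_pow_short:
  assumes h: "h \<in> H" and y: "is_commutator G y"
  shows "\<exists>k g h'. k < (n * n + n) ^ (n * n + n) \<and> g \<in> carrier G \<and> h' \<in> H \<and>
    comm h y [^] Suc (Suc k) = comm h' y \<otimes> conj_by g (comm h y) [^] k"
proof -
  have yc: "y \<in> carrier G" using y by (rule is_commutator_carrier)
  obtain us where us: "set us \<subseteq> commutators" "length us \<le> n" "conj_by (word us) y = conj_by h y"
    using ex_short_word_conj[OF h y] by blast
  define h1 where "h1 = word us"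
  have usc: "set us \<subseteq> carrier G" using us(1) commutators_closed by auto
  have h1: "h1 \<in> H" "h1 \<in> carrier G" using us(1) word_in_H H_carrier by (auto simp: h1_def)
  have eq: "comm h y = comm h1 y"
    using us(3) h H_carrier yc h1 by (simp add: comm_eq h1_def)
  \<comment> \<open>An element fixing \<open>T\<close> pointwise commutes with \<open>y\<close> and
    with every letter of \<open>us\<close>, hence with \<open>h1\<close>. Whole classes make
    \<open>T\<close> conjugation-invariant; there are at most \<open>n + 1\<close> of them, each of
    size at most \<open>n\<close>.\<close>
  define T where "T = (\<Union>u\<in>set (y # us). conj_class G u)"
  have com: "\<And>u. u \<in> set (y # us) \<Longrightarrow> is_commutator G u" using us(1) y by auto
  have "card (set (y # us)) \<le> Suc n" using us(2) card_length[of "y # us"] by simp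
  then have "card (set (y # us)) * n \<le> n * n + n" 
    using mult_le_mono1[of _ "Suc n" n] by (metis add.commute mult_Suc)
  then have T: "finite T" "conj_closed T" "card T \<le> n * n + n"
    unfolding T_def
    using card_UN_conj_class[of "set (y # us)" "\<lambda>u. u", OF _ com]
      conj_closed_UN[of "set (y # us)" "\<lambda>u. u", OF com] by (blast intro: order_trans)+
  have inT: "u \<in> T" if "u \<in> set (y # us)" for u
    using that self_in_conj_class[OF is_commutator_carrier[OF com[OF that]]] unfolding T_def by blast
  have sc: "comm h1 y \<in> carrier G" using h1 yc by simp
  obtain k where k: "0 < k" "k \<le> card T ^ card T" "\<forall>s\<in>T. conj_by (comm h1 y [^] k) s = s"
    using ex_pow_centralizing[OF T(1,2) sc] by blast
  then obtain j where j: "k = Suc j" by (cases k) auto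
  have "conj_by (comm h1 y [^] k) y = y" using k(3) inT by simp
  moreover have "conj_by (comm h1 y [^] k) h1 = h1"
    unfolding h1_def using k(3) inT sc usc by (intro conj_by_word_fixed) (auto simp: h1_def)
  ultimately have "comm h1 y [^] Suc (Suc j) =
      comm (h1 \<otimes> h1) y \<otimes> conj_by (inv y \<otimes> h1 \<otimes> y) (comm h1 y) [^] j"
    using comm_pow_eq[OF h1(2) yc, of j] unfolding j by blast
  moreover have "j < (n * n + n) ^ (n * n + n)"
    using k(2) self_power_mono[OF T(3)] j by linarith
  ultimately show ?thesis
    using h1 yc subgroup.m_closed[OF H_subgroup] unfolding eq
    by (intro exI[of _ j] exI[of _ "inv y \<otimes> h1 \<otimes> y"] exI[of _ "h1 \<otimes> h1"]) auto
qed

text \<open>\<open>N\<close> is generated by the set \<open>S\<close> of all these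
  \<open>[h, y]\<close>. Each equals \<open>(y^h)^-1 y\<close> and so is determined by two elements
  of the class, which gives at most \<open>n * n\<close> generators. \<open>comm_pow_short\<close>
  supplies the shortening of powers that \<open>card_generate_le\<close> requires.\<close>

lemma ex_finite_normal_commutators:
  assumes x: "is_commutator G x"
  shows "\<exists>N. N \<lhd> G \<and> finite N \<and> card N \<le> order_bound n \<and>
    (\<forall>h\<in>H. \<forall>y\<in>conj_class G x. comm h y \<in> N)"
proof -
  define C where "C = conj_class G x"
  have C: "finite C" "card C \<le> n" "conj_closed C"
    using finite_conj_class[OF x] card_conj_class[OF x] conj_closed_conj_class is_commutator_carrier[OF x]
    by (auto simp: C_def)
  have Cc: "y \<in> carrier G" "is_commutator G y" if "y \<in> C" for y
    using that is_commutator_conj_class[OF x] is_commutator_carrier unfolding C_def by blast+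
  define S where "S = {comm h y |h y. h \<in> H \<and> y \<in> C}"
  have cy: "conj_by g y \<in> C" if "g \<in> carrier G" "y \<in> C" for g y
    using C(3) that by (auto simp: conj_closed_def)
  have Ssub: "S \<subseteq> (\<lambda>(a, b). inv a \<otimes> b) ` (C \<times> C)"
    using cy H_carrier Cc by (fastforce simp: S_def comm_eq)
  then have S: "finite S" "card S \<le> card (C \<times> C)"
    using finite_surj[OF _ Ssub] surj_card_le[OF _ Ssub] C(1) by blast+
  have "card (C \<times> C) \<le> n * n" using C(2) by (simp add: card_cartesian_product mult_le_mono)
  with S(2) have Sn: "card S \<le> n * n" by linarith
  have Scc: "conj_closed S"
    unfolding conj_closed_def
  proof (intro conjI ballI)
    show "S \<subseteq> carrier G" using H_carrier Cc by (auto simp: S_def)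
    fix g s assume g: "g \<in> carrier G" and "s \<in> S"
    then obtain h y where s: "s = comm h y" "h \<in> H" "y \<in> C" by (auto simp: S_def)
    then have "conj_by g s = comm (conj_by g h) (conj_by g y)" "conj_by g h \<in> H" "conj_by g y \<in> C"
      using g H_carrier Cc cy normal_conj_by[OF H_normal] by (auto simp: conj_by_comm)
    then show "conj_by g s \<in> S" by (auto simp: S_def)
  qed
  have Sinv: "inv s \<in> S" if "s \<in> S" for s
  proof -
    obtain h y where s: "s = comm h y" "h \<in> H" "y \<in> C" using \<open>s \<in> S\<close> by (auto simp: S_def)
    then have hc: "h \<in> carrier G" "y \<in> carrier G" using H_carrier Cc by auto
    \<comment> \<open>The inverse of \<open>(y^h)^-1 y\<close> is \<open>y^-1 y^h\<close>, and
      \<open>y\<close> is the conjugate of \<open>y^h\<close> by \<open>h^-1\<close>.\<close>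
    have "inv s = comm (inv h) (conj_by h y)"
      using hc by (simp add: s(1) comm_eq inv_mult_group)
    moreover have "inv h \<in> H" "conj_by h y \<in> C"
      using s hc cy subgroup.m_inv_closed[OF H_subgroup] by auto
    ultimately show ?thesis by (auto simp: S_def)
  qed
  have Sshort: "\<exists>zs. set zs \<subseteq> S \<and> length zs \<le> (n * n + n) ^ (n * n + n) \<and> s [^] Suc (length zs) = word zs"
    if "s \<in> S" for s
  proof -
    obtain h y where s: "s = comm h y" "h \<in> H" "y \<in> C" using \<open>s \<in> S\<close> by (auto simp: S_def)
    obtain k g h' where k: "k < (n * n + n) ^ (n * n + n)" "g \<in> carrier G" "h' \<in> H"
      "s [^] Suc (Suc k) = comm h' y \<otimes> conj_by g s [^] k"
      using comm_pow_short[OF s(2) Cc(2)[OF s(3)]] unfolding s(1) by blast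
    have "comm h' y \<in> S" "conj_by g s \<in> S"
      using k s(3) Scc that by (auto simp: S_def conj_closed_def)
    moreover have "s \<in> carrier G" using Scc that by (auto simp: conj_closed_def)
    \<comment> \<open>The factor \<open>[h', y]\<close> and the \<open>k\<close> conjugates form a
      word of length \<open>Suc k\<close>, which the strict bound on \<open>k\<close> keeps within
      the limit.\<close>
    ultimately show ?thesis
      using k by (intro exI[of _ "comm h' y # replicate k (conj_by g s)"])
        (auto simp: word_replicate simp del: nat_pow_Suc)
  qed
  have N: "finite (generate G S)" "card (generate G S) \<le> order_bound n"
    using card_generate_le[OF Scc S(1) Sinv Sshort Sn] by (auto simp: order_bound_def)
  have "generate G S \<lhd> G"
  proof (rule normal_generateI)
    show "S \<subseteq> carrier G" using Scc by (auto simp: conj_closed_def)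
    fix s g assume "s \<in> S" "g \<in> carrier G"
    then have "conj_by (inv g) s \<in> S" using Scc by (auto simp: conj_closed_def)
    then show "g \<otimes> s \<otimes> inv g \<in> S" using \<open>g \<in> carrier G\<close> by (simp add: conj_by_def)
  qed
  moreover have "\<forall>h\<in>H. \<forall>y\<in>conj_class G x. comm h y \<in> generate G S"
    by (auto simp: S_def C_def intro: generate.incl)
  ultimately show ?thesis using N by blast
qed

end

section \<open>Centralizers of finite sets, and products of normal subgroups\<close>

context group
begin

text \<open>For \<open>S\<close> inside the carrier this is the centralizer of \<open>S\<close>; for
  conjugation-invariant \<open>S\<close> it is the kernel of the action of \<open>G\<close> on
  \<open>S\<close>.\<close>

definition fixer :: "'a set \<Rightarrow> 'a set" where
  "fixer S = {g \<in> carrier G. \<forall>s\<in>S. conj_by g s = s}"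

lemma fixer_closed: "g \<in> fixer S \<Longrightarrow> g \<in> carrier G"
  by (simp add: fixer_def)

lemma fixer_antimono: "S \<subseteq> T \<Longrightarrow> fixer T \<subseteq> fixer S"
  by (auto simp: fixer_def)

lemma one_in_fixer: "conj_closed S \<Longrightarrow> \<one> \<in> fixer S"
  by (auto simp: fixer_def conj_closed_def)

lemma conj_by_comm_fixer:
  assumes S: "conj_closed S" and u: "u \<in> fixer S" "v \<in> fixer S"
    and d: "d \<in> carrier G" "e \<in> carrier G" and s: "s \<in> S"
  shows "conj_by (comm (d \<otimes> u) (e \<otimes> v)) s = conj_by (comm d e) s"
proof -
  have c: "t \<in> carrier G" "conj_by g t \<in> S" if "t \<in> S" "g \<in> carrier G" for g t
    using S that by (auto simp: conj_closed_def)
  have fixed: "conj_by w t = t" "conj_by (inv w) t = t" if "w \<in> fixer S" "t \<in> S" for w t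
    using that c(1)[OF that(2) one_closed] conj_by_inv_cancel(2)[of w t] by (auto simp: fixer_def)
  show ?thesis
    using u s d fixer_closed[OF u(1)] fixer_closed[OF u(2)]
    by (simp add: group_commutator_def conj_by_mult inv_mult_group c fixed)
qed

text \<open>Elements acting alike on \<open>S\<close> differ by a factor in \<open>fixer S\<close>.
  The set \<open>R\<close> expresses bounded index without speaking of cosets.\<close>

lemma ex_fixer_transversal:
  assumes "finite S" "conj_closed S"
  shows "\<exists>R. R \<subseteq> carrier G \<and> finite R \<and> card R \<le> card S ^ card S \<and>
    (\<forall>g\<in>carrier G. \<exists>r\<in>R. \<exists>u\<in>fixer S. g = r \<otimes> u)"
proof -
  obtain R where R: "R \<subseteq> carrier G" "finite R" "card R \<le> card S ^ card S"
    "\<forall>g\<in>carrier G. \<exists>r\<in>R. \<forall>s\<in>S. conj_by g s = conj_by r s"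
    using ex_conj_action_transversal[OF assms] by blast
  have "\<exists>r\<in>R. \<exists>u\<in>fixer S. g = r \<otimes> u" if g: "g \<in> carrier G" for g
  proof -
    obtain r where r: "r \<in> R" "\<forall>s\<in>S. conj_by g s = conj_by r s" using R(4) g by blast
    have rc: "r \<in> carrier G" using R(1) r(1) by blast
    have "conj_by (inv r \<otimes> g) s = s" if s: "s \<in> S" for s
    proof -
      have sc: "s \<in> carrier G" "conj_by (inv r) s \<in> S"
        using s assms(2) rc by (auto simp: conj_closed_def)
      then show ?thesis using g rc r(2) by (simp add: conj_by_mult)
    qed
    then have "inv r \<otimes> g \<in> fixer S" using g rc by (simp add: fixer_def)
    moreover have "g = r \<otimes> (inv r \<otimes> g)" using g rc by (simp add: inv_cancel_left')
    ultimately show ?thesis using r(1) by blast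
  qed
  with R(1-3) show ?thesis by blast
qed

text \<open>\<open>M\<close> is the product of all members of the family, formed one factor at a
  time; orders at most multiply.\<close>

lemma ex_normal_containing:
  assumes "finite \<N>" "\<And>N. N \<in> \<N> \<Longrightarrow> N \<lhd> G \<and> finite N \<and> card N \<le> c"
  shows "\<exists>M. M \<lhd> G \<and> finite M \<and> card M \<le> c ^ card \<N> \<and> (\<forall>N\<in>\<N>. N \<subseteq> M)"
  using assms
proof (induction \<N> rule: finite_induct)
  case empty
  show ?case using one_is_normal by (intro exI[of _ "{\<one>}"]) simp
next
  case (insert N \<N>)
  then obtain M where M: "M \<lhd> G" "finite M" "card M \<le> c ^ card \<N>" "\<forall>N\<in>\<N>. N \<subseteq> M" by blast
  have N: "N \<lhd> G" "finite N" "card N \<le> c" using insert.prems by auto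
  have eq: "N <#> M = (\<lambda>(x, y). x \<otimes> y) ` (N \<times> M)" by (auto simp: set_mult_def)
  have sub: "subgroup N G" "subgroup M G" using N(1) M(1) normal_imp_subgroup by auto
  have "x \<in> N <#> M" if "x \<in> N" for x
    unfolding eq using that subgroup.one_closed[OF sub(2)] subgroup.mem_carrier[OF sub(1)]
    by (intro image_eqI[of _ _ "(x, \<one>)"]) auto
  moreover have "x \<in> N <#> M" if "x \<in> M" for x
    unfolding eq using that subgroup.one_closed[OF sub(1)] subgroup.mem_carrier[OF sub(2)]
    by (intro image_eqI[of _ _ "(\<one>, x)"]) auto
  ultimately have "\<forall>N'\<in>insert N \<N>. N' \<subseteq> N <#> M" using M(4) by blast
  moreover have "card (N <#> M) \<le> c ^ card (insert N \<N>)"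
  proof -
    have "card (N <#> M) \<le> card N * card M"
      unfolding eq card_cartesian_product[symmetric] using N M by (intro card_image_le) auto
    also have "\<dots> \<le> c * c ^ card \<N>" using N M by (intro mult_le_mono) auto
    finally show ?thesis using insert.hyps by simp
  qed
  moreover have "finite (N <#> M)" unfolding eq using N M by simp
  ultimately show ?case using normal_subgroup_set_mult_closed[OF N(1) M(1)] by blast
qed

end

text \<open>Here \<open>r\<close> and \<open>s ^ s\<close> bound the indices of \<open>U\<close> and \<open>V\<close>, and the exponent counts the normal
  subgroups that are multiplied together: one for \<open>U\<close>, one for each element of a transversal of \<open>U\<close>, and one for each
  pair of elements of a transversal of \<open>V\<close>.\<close>

definition second_derived_bound :: "nat \<Rightarrow> nat" where
  "second_derived_bound n =
    (let m = n * n * n; r = m ^ m; s = m + r * m in order_bound n ^ (1 + r + s ^ s * s ^ s))"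

text \<open>The empty word contributes 1, even for \<open>n = 0\<close>. This makes powers of
  \<open>order_bound n\<close> monotone in the exponent.\<close>

lemma order_bound_ge_1: "1 \<le> order_bound n"
proof -
  have "(n * n) ^ 0 \<le> order_bound n" unfolding order_bound_def by (rule member_le_sum) auto
  then show ?thesis by simp
qed

section \<open>Centralizers of the derived group modulo a normal subgroup\<close>

context bounded_commutator_classes
begin

text \<open>This is \<open>Z(N)\<close> for normal \<open>N\<close>, described inside
  \<open>G\<close> so that no quotient group has to be formed.\<close>

definition centralizer_mod :: "'a set \<Rightarrow> 'a set" where
  "centralizer_mod N = {g \<in> carrier G. \<forall>h\<in>H. comm h g \<in> N}"

lemma centralizer_mod_mono: "N \<subseteq> M \<Longrightarrow> centralizer_mod N \<subseteq> centralizer_mod M"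
  by (auto simp: centralizer_mod_def)

lemma centralizer_mod_normal:
  assumes N: "N \<lhd> G"
  shows "centralizer_mod N \<lhd> G"
proof (rule normal_invI)
  have sub: "subgroup N G" using N by (rule normal_imp_subgroup)
  note closed = subgroup.one_closed[OF sub] subgroup.m_closed[OF sub] subgroup.m_inv_closed[OF sub]
  show "subgroup (centralizer_mod N) G"
  proof (rule subgroupI)
    show "centralizer_mod N \<subseteq> carrier G" by (auto simp: centralizer_mod_def)
    have "comm h \<one> = \<one>" if "h \<in> H" for h
      using H_carrier[OF that] by (simp add: group_commutator_def)
    then have "\<one> \<in> centralizer_mod N" using closed by (simp add: centralizer_mod_def)
    then show "centralizer_mod N \<noteq> {}" by blast
  next
    fix a assume a: "a \<in> centralizer_mod N"
    then have ac: "a \<in> carrier G" by (simp add: centralizer_mod_def)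
    have "comm h (inv a) \<in> N" if h: "h \<in> H" for h
    proof -
      have "comm h (inv a) = inv (conj_by (inv a) (comm h a))"
        using ac H_carrier[OF h] by (simp add: group_commutator_def conj_by_def cancel_simps)
      then show ?thesis
        using a h ac closed normal_conj_by[OF N, of "inv a"] by (simp add: centralizer_mod_def)
    qed
    then show "inv a \<in> centralizer_mod N" using ac by (simp add: centralizer_mod_def)
  next
    fix a b assume "a \<in> centralizer_mod N" "b \<in> centralizer_mod N"
    then show "a \<otimes> b \<in> centralizer_mod N"
      using closed normal_conj_by[OF N] H_carrier by (simp add: centralizer_mod_def comm_mult_right)
  qed
next
  fix x g assume x: "x \<in> carrier G" and g: "g \<in> centralizer_mod N"
  then have gc: "g \<in> carrier G" by (simp add: centralizer_mod_def)
  have "comm h (x \<otimes> g \<otimes> inv x) \<in> N" if h: "h \<in> H" for h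
  proof -
    have "comm h (x \<otimes> g \<otimes> inv x) = conj_by (inv x) (comm (conj_by x h) g)"
      using x gc H_carrier[OF h] by (simp add: group_commutator_def conj_by_def cancel_simps)
    moreover have "conj_by x h \<in> H" using normal_conj_by[OF H_normal x h] .
    ultimately show ?thesis
      using g x normal_conj_by[OF N, of "inv x"] by (simp add: centralizer_mod_def)
  qed
  then show "x \<otimes> g \<otimes> inv x \<in> centralizer_mod N" using x gc by (simp add: centralizer_mod_def)
qed

text \<open>The maximality argument. Membership in \<open>Z(N)\<close> is reduced to a condition on
  the action on a small invariant set \<open>S\<close>, which later persists when arguments of
  commutators are multiplied by elements of \<open>fixer S\<close>.\<close>

lemma ex_centralizing_mod:
  assumes D: "D \<subseteq> commutators" "D \<noteq> {}"
  shows "\<exists>N S. \<exists>a\<in>D. N \<lhd> G \<and> finite N \<and> card N \<le> order_bound n \<and>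
    finite S \<and> conj_closed S \<and> card S \<le> n * n * n \<and>
    (\<forall>x\<in>D. (\<forall>s\<in>S. conj_by x s = conj_by a s) \<longrightarrow> x \<in> centralizer_mod N)"
proof -
  define orb where "orb x = (\<lambda>h. conj_by h x) ` H" for x
  have Dc: "is_commutator G x" "x \<in> carrier G" if "x \<in> D" for x
    using that D(1) is_commutator_carrier by auto
  have orb: "finite (orb x)" "card (orb x) \<le> n" if "x \<in> D" for x
  proof -
    have sub: "orb x \<subseteq> conj_class G x" using H_carrier by (auto simp: orb_def conj_class_eq)
    then show "finite (orb x)" using finite_conj_class[OF Dc(1)[OF that]] finite_subset by blast
    show "card (orb x) \<le> n"
      using card_mono[OF finite_conj_class[OF Dc(1)[OF that]] sub] card_conj_class[OF Dc(1)[OF that]]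
      by linarith
  qed
  obtain a where a: "a \<in> D" "\<And>x. x \<in> D \<Longrightarrow> card (orb x) \<le> card (orb a)"
  proof -
    obtain x0 where "x0 \<in> D" using D(2) by blast
    then have "\<exists>k. (\<exists>x\<in>D. card (orb x) = k) \<and> (\<forall>l. (\<exists>x\<in>D. card (orb x) = l) \<longrightarrow> l \<le> k)"
      using orb by (intro Nat.ex_has_greatest_nat[where k = "card (orb x0)" and b = n]) auto
    then show ?thesis using that by blast
  qed
  have "\<forall>y\<in>orb a. \<exists>ws. set ws \<subseteq> commutators \<and> length ws \<le> n \<and> conj_by (word ws) a = y"
    using ex_short_word_conj[OF _ Dc(1)[OF a(1)]] by (auto simp: orb_def)
  then obtain w where w: "\<And>y. y \<in> orb a \<Longrightarrow> set (w y) \<subseteq> commutators"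
    "\<And>y. y \<in> orb a \<Longrightarrow> length (w y) \<le> n" "\<And>y. y \<in> orb a \<Longrightarrow> conj_by (word (w y)) a = y"
    by metis
  \<comment> \<open>\<open>U\<close> collects the letters of at most \<open>n\<close> words of
    length at most \<open>n\<close>. Passing to their full classes costs another factor
    \<open>n\<close> and makes \<open>S\<close> invariant.\<close>
  define U where "U = (\<Union>y\<in>orb a. set (w y))"
  define S where "S = (\<Union>u\<in>U. conj_class G u)"
  have U: "finite U" "\<And>u. u \<in> U \<Longrightarrow> is_commutator G u"
    using orb(1)[OF a(1)] w(1) by (auto simp: U_def)
  have "card U \<le> (\<Sum>y\<in>orb a. card (set (w y)))"
    unfolding U_def using orb(1)[OF a(1)] by (rule card_UN_le)
  also have "\<dots> \<le> of_nat (card (orb a)) * n"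
    using w(2) card_length le_trans by (intro sum_bounded_above) blast
  also have "\<dots> \<le> n * n" using orb(2)[OF a(1)] by simp
  finally have "card U * n \<le> n * n * n" by simp
  then have S: "finite S" "conj_closed S" "card S \<le> n * n * n"
    unfolding S_def
    using card_UN_conj_class[OF U(1), of "\<lambda>u. u", OF U(2)]
      conj_closed_UN[of U "\<lambda>u. u", OF U(2)] by (blast intro: order_trans)+
  obtain N where N: "N \<lhd> G" "finite N" "card N \<le> order_bound n"
    "\<forall>h\<in>H. \<forall>y\<in>conj_class G a. comm h y \<in> N"
    using ex_finite_normal_commutators[OF Dc(1)[OF a(1)]] by blast
  have ac: "a \<in> carrier G" by (rule Dc(2)[OF a(1)])
  have "x \<in> centralizer_mod N" if x: "x \<in> D" and act: "\<forall>s\<in>S. conj_by x s = conj_by a s" for x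
  proof -
    have xc: "x \<in> carrier G" by (rule Dc(2)[OF x])
    define u where "u = x \<otimes> inv a"
    have uc: "u \<in> carrier G" and xu: "x = u \<otimes> a"
      using xc ac by (simp_all add: u_def m_assoc)
    have orb_a: "y \<in> carrier G" if "y \<in> orb a" for y
      using that ac H_carrier by (auto simp: orb_def)
    have fixed: "conj_by u s = s" if "s \<in> U" for s
    proof -
      have "s \<in> S" "s \<in> carrier G"
        using that is_commutator_carrier[OF U(2)[OF that]] self_in_conj_class by (auto simp: S_def)
      then show ?thesis using act xc ac by (simp add: u_def conj_by_mult)
    qed
    have word_w: "word (w y) \<in> H" "word (w y) \<in> carrier G" if "y \<in> orb a" for y
      using word_in_H[OF w(1)[OF that]] H_carrier by auto
    \<comment> \<open>\<open>u\<close> fixes every letter of \<open>w y\<close>, hence commutes with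
      the word; conjugating \<open>x = u a\<close> by it therefore changes only the factor
      \<open>a\<close>.\<close>
    have shift: "conj_by (word (w y)) x = u \<otimes> y" if y: "y \<in> orb a" for y
    proof -
      have "set (w y) \<subseteq> carrier G" using w(1)[OF y] commutators_closed by (rule subset_trans)
      then have "conj_by u (word (w y)) = word (w y)"
        using y uc fixed by (intro conj_by_word_fixed) (auto simp: U_def)
      then have "conj_by (word (w y)) u = u"
        using uc word_w(2)[OF y] by (simp add: conj_by_eq_self_iff)
      then show ?thesis using uc ac word_w(2)[OF y] w(3)[OF y] by (simp add: xu conj_by_prod)
    qed
    \<comment> \<open>The translate lies in \<open>orb x\<close> and has as many elements as
      \<open>orb a\<close>, so maximality of \<open>a\<close> forces equality.\<close>
    have "(\<otimes>) u ` orb a = orb x"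
    proof (rule card_seteq)
      show "finite (orb x)" by (rule orb(1)[OF x])
      show "(\<otimes>) u ` orb a \<subseteq> orb x" using shift word_w(1) by (force simp: orb_def[of x])
      have "inj_on ((\<otimes>) u) (orb a)" using uc orb_a by (auto intro!: inj_onI)
      then show "card (orb x) \<le> card ((\<otimes>) u ` orb a)" using a(2)[OF x] by (simp add: card_image)
    qed
    then have orb_x: "\<exists>k\<in>H. conj_by h x = u \<otimes> conj_by k a" if "h \<in> H" for h
      using that by (auto simp: orb_def)
    have "comm h x \<in> N" if h: "h \<in> H" for h
    proof -
      obtain k where k: "k \<in> H" "conj_by h x = u \<otimes> conj_by k a" using orb_x[OF h] by blast
      \<comment> \<open>In \<open>[h, x] = (x^h)^-1 x = (u a^k)^-1 (u a)\<close> the factor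
        \<open>u\<close> cancels.\<close>
      have "comm h x = inv (conj_by k a) \<otimes> a"
        using H_carrier[OF h] H_carrier[OF k(1)] xc ac uc
        by (simp add: comm_eq k(2)) (simp add: xu cancel_simps)
      also have "\<dots> = comm k a" using H_carrier[OF k(1)] ac by (simp add: comm_eq)
      finally show ?thesis using N(4) k(1) self_in_conj_class[OF ac] by simp
    qed
    then show ?thesis using xc by (simp add: centralizer_mod_def)
  qed
  then show ?thesis using N S a(1) by blast
qed

text \<open>With \<open>a = [d, e]\<close> maximal, all \<open>[d u, e v]\<close> act on
  \<open>S\<close> like \<open>a\<close> and so lie in \<open>Z(N)\<close>. The cases with
  \<open>u\<close> or \<open>v\<close> trivial are cancelled from the expansion of the general one:
  first \<open>[d, v]\<close>, then \<open>[d u, v]\<close>, finally \<open>[u, v]\<close>.\<close>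

lemma ex_fixer_commutators_central:
  "\<exists>N S. N \<lhd> G \<and> finite N \<and> card N \<le> order_bound n \<and>
    finite S \<and> conj_closed S \<and> card S \<le> n * n * n \<and>
    (\<forall>u\<in>fixer S. \<forall>v\<in>fixer S. comm u v \<in> centralizer_mod N)"
proof -
  have "commutators \<noteq> {}" using is_commutator_comm[of \<one> \<one>] by auto
  then obtain N S a where a: "a \<in> commutators"
    and N: "N \<lhd> G" "finite N" "card N \<le> order_bound n"
    and S: "finite S" "conj_closed S" "card S \<le> n * n * n"
    and Z: "\<forall>x\<in>commutators. (\<forall>s\<in>S. conj_by x s = conj_by a s) \<longrightarrow> x \<in> centralizer_mod N"
    using ex_centralizing_mod[OF order_refl] by blast
  obtain d e where d: "d \<in> carrier G" "e \<in> carrier G" "a = comm d e"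
    using a by (auto simp: commutators_eq)
  note Znormal = centralizer_mod_normal[OF N(1)]
  note Zsub = normal_imp_subgroup[OF Znormal]
  have key: "comm (d \<otimes> u) (e \<otimes> v) \<in> centralizer_mod N" if "u \<in> fixer S" "v \<in> fixer S" for u v
    using Z conj_by_comm_fixer[OF S(2) that d(1,2)] d fixer_closed that is_commutator_comm by simp
  have "comm u v \<in> centralizer_mod N" if uv: "u \<in> fixer S" "v \<in> fixer S" for u v
  proof -
    have c: "u \<in> carrier G" "v \<in> carrier G" using uv fixer_closed by auto
    note one = one_in_fixer[OF S(2)]
    have Z_cancel: "y \<in> centralizer_mod N"
      if "x \<otimes> y \<in> centralizer_mod N" "x \<in> centralizer_mod N" "y \<in> carrier G" for x y
      using that subgroup.m_closed[OF Zsub subgroup.m_inv_closed[OF Zsub that(2)] that(1)]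
        subgroup.mem_carrier[OF Zsub that(2)] by (simp add: inv_cancel_left)
    have Z_cancel': "x \<in> centralizer_mod N"
      if "x \<otimes> y \<in> centralizer_mod N" "y \<in> centralizer_mod N" "x \<in> carrier G" for x y
      using that subgroup.m_closed[OF Zsub that(1) subgroup.m_inv_closed[OF Zsub that(2)]]
        subgroup.mem_carrier[OF Zsub that(2)] by (simp add: m_assoc)
    have de: "comm d e \<in> centralizer_mod N" using key[OF one one] d by simp
    have du_e: "comm (d \<otimes> u) e \<in> centralizer_mod N" using key[OF uv(1) one] d by simp
    have d_ev: "comm d (e \<otimes> v) \<in> centralizer_mod N" using key[OF one uv(2)] d by simp
    have dv: "comm d v \<in> centralizer_mod N"
    proof (rule Z_cancel')
      show "comm d v \<otimes> conj_by v (comm d e) \<in> centralizer_mod N"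
        using d_ev d c by (simp add: comm_mult_right)
    qed (use d c de normal_conj_by[OF Znormal] in auto)
    have du_v: "comm (d \<otimes> u) v \<in> centralizer_mod N"
    proof (rule Z_cancel')
      show "comm (d \<otimes> u) v \<otimes> conj_by v (comm (d \<otimes> u) e) \<in> centralizer_mod N"
        using key[OF uv] d c by (simp add: comm_mult_right)
    qed (use d c du_e normal_conj_by[OF Znormal] in auto)
    show ?thesis
    proof (rule Z_cancel)
      show "conj_by u (comm d v) \<otimes> comm u v \<in> centralizer_mod N"
        using du_v d c by (simp add: comm_mult_left)
    qed (use d c dv normal_conj_by[OF Znormal] in auto)
  qed
  with N S show ?thesis by blast
qed

text \<open>Maximizing only over the \<open>[d, e]\<close> with \<open>d\<close> fixed, both
  \<open>a = [d, e]\<close> and \<open>[d, e v] = [d, v] [d, e]^v\<close> lie in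
  \<open>Z(N)\<close>, hence so does \<open>[d, v]\<close>.\<close>

lemma ex_comm_fixer_central:
  assumes d: "d \<in> carrier G"
  shows "\<exists>N S. N \<lhd> G \<and> finite N \<and> card N \<le> order_bound n \<and>
    finite S \<and> conj_closed S \<and> card S \<le> n * n * n \<and>
    (\<forall>v\<in>fixer S. comm d v \<in> centralizer_mod N)"
proof -
  define D where "D = comm d ` carrier G"
  have "D \<subseteq> commutators" "D \<noteq> {}" using d is_commutator_comm by (auto simp: D_def)
  then obtain N S a where a: "a \<in> D"
    and N: "N \<lhd> G" "finite N" "card N \<le> order_bound n"
    and S: "finite S" "conj_closed S" "card S \<le> n * n * n"
    and Z: "\<forall>x\<in>D. (\<forall>s\<in>S. conj_by x s = conj_by a s) \<longrightarrow> x \<in> centralizer_mod N"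
    using ex_centralizing_mod[of D] by blast
  obtain e where e: "e \<in> carrier G" "a = comm d e" using a by (auto simp: D_def)
  note Znormal = centralizer_mod_normal[OF N(1)]
  note Zsub = normal_imp_subgroup[OF Znormal]
  have "comm d v \<in> centralizer_mod N" if v: "v \<in> fixer S" for v
  proof -
    have c: "v \<in> carrier G" using v fixer_closed by auto
    have "a \<in> centralizer_mod N" using Z a by blast
    then have a': "conj_by v a \<in> centralizer_mod N" using normal_conj_by[OF Znormal c] by blast
    have "conj_by (comm d (e \<otimes> v)) s = conj_by a s" if "s \<in> S" for s
      using conj_by_comm_fixer[OF S(2) one_in_fixer[OF S(2)] v d e(1) that] d e by simp
    then have "comm d (e \<otimes> v) \<in> centralizer_mod N" using Z c e(1) by (auto simp: D_def)
    then have "comm d v \<otimes> conj_by v a \<in> centralizer_mod N"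
      using c d e by (simp add: comm_mult_right)
    from subgroup.m_closed[OF Zsub this subgroup.m_inv_closed[OF Zsub a']] show ?thesis
      using c d subgroup.mem_carrier[OF Zsub a'] by (simp add: m_assoc)
  qed
  with N S show ?thesis by blast
qed

lemma second_derived_bounded:
  "finite (second_derived G)" "card (second_derived G) \<le> second_derived_bound n"
proof -
  define m where "m = n * n * n"
  define r where "r = m ^ m"
  define s where "s = m + r * m"
  obtain N1 S1 where N1: "N1 \<lhd> G" "finite N1" "card N1 \<le> order_bound n"
    and S1: "finite S1" "conj_closed S1" "card S1 \<le> m"
    and Z1: "\<forall>u\<in>fixer S1. \<forall>v\<in>fixer S1. comm u v \<in> centralizer_mod N1"
    using ex_fixer_commutators_central unfolding m_def by blast
  obtain R1 where R1: "R1 \<subseteq> carrier G" "finite R1" "card R1 \<le> card S1 ^ card S1"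
    "\<forall>g\<in>carrier G. \<exists>t\<in>R1. \<exists>u\<in>fixer S1. g = t \<otimes> u"
    using ex_fixer_transversal[OF S1(1,2)] by blast
  have R1_card: "card R1 \<le> r" using R1(3) self_power_mono[OF S1(3)] unfolding r_def by linarith
  have "\<forall>d\<in>carrier G. \<exists>N S. N \<lhd> G \<and> finite N \<and> card N \<le> order_bound n \<and>
    finite S \<and> conj_closed S \<and> card S \<le> m \<and> (\<forall>v\<in>fixer S. comm d v \<in> centralizer_mod N)"
    using ex_comm_fixer_central unfolding m_def by blast
  then obtain N2 S2 where N2: "\<And>d. d \<in> carrier G \<Longrightarrow> N2 d \<lhd> G \<and> finite (N2 d) \<and> card (N2 d) \<le> order_bound n \<and>
    finite (S2 d) \<and> conj_closed (S2 d) \<and> card (S2 d) \<le> m \<and>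
    (\<forall>v\<in>fixer (S2 d). comm d v \<in> centralizer_mod (N2 d))"
    by metis
  \<comment> \<open>\<open>fixer S\<close> is the subgroup \<open>V\<close>: it lies in
    \<open>U = fixer S1\<close> and in \<open>fixer (S2 d)\<close> for each representative
    \<open>d\<close> of \<open>U\<close>.\<close>
  define S where "S = \<Union>(insert S1 (S2 ` R1))"
  have S: "finite S" "conj_closed S"
    unfolding S_def using S1 N2 R1(1,2) by (auto simp del: Sup_insert intro!: conj_closed_Union)
  have "card S \<le> card S1 + card (\<Union>d\<in>R1. S2 d)"
    unfolding S_def by (metis Sup_insert card_Un_le)
  also have "\<dots> \<le> m + (\<Sum>d\<in>R1. card (S2 d))"
    using S1(3) R1(2) by (intro add_mono card_UN_le)
  also have "\<dots> \<le> m + of_nat (card R1) * m"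
    using N2 R1(1) by (intro add_left_mono sum_bounded_above) blast
  also have "\<dots> \<le> s" using R1_card by (simp add: s_def)
  finally have S_card: "card S \<le> s" .
  obtain R where R: "R \<subseteq> carrier G" "finite R" "card R \<le> card S ^ card S"
    "\<forall>g\<in>carrier G. \<exists>t\<in>R. \<exists>u\<in>fixer S. g = t \<otimes> u"
    using ex_fixer_transversal[OF S] by blast
  have R_card: "card R \<le> s ^ s" using R(3) self_power_mono[OF S_card] by linarith
  have "\<exists>N. N \<lhd> G \<and> finite N \<and> card N \<le> order_bound n \<and> x \<in> centralizer_mod N"
    if x: "is_commutator G x" for x
  proof -
    have "x \<in> carrier G" "x \<in> conj_class G x"
      using is_commutator_carrier[OF x] self_in_conj_class by auto
    then show ?thesis
      using ex_finite_normal_commutators[OF x] by (auto simp: centralizer_mod_def)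
  qed
  then obtain N3 where N3: "\<And>x. is_commutator G x \<Longrightarrow> N3 x \<lhd> G \<and> finite (N3 x) \<and>
      card (N3 x) \<le> order_bound n \<and> x \<in> centralizer_mod (N3 x)"
    by metis
  define \<N> where "\<N> = insert N1 (N2 ` R1 \<union> (\<lambda>(x, y). N3 (comm x y)) ` (R \<times> R))"
  have fin: "finite \<N>" using R1(2) R(2) by (simp add: \<N>_def)
  have "card \<N> \<le> Suc (card (N2 ` R1 \<union> (\<lambda>(x, y). N3 (comm x y)) ` (R \<times> R)))"
    unfolding \<N>_def by (rule card_insert_le_m1[OF zero_less_Suc]) simp
  also have "\<dots> \<le> Suc (card (N2 ` R1) + card ((\<lambda>(x, y). N3 (comm x y)) ` (R \<times> R)))"
    using card_Un_le by simp
  also have "\<dots> \<le> Suc (card R1 + card (R \<times> R))"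
    using R1(2) R(2) by (intro Suc_le_mono[THEN iffD2] add_mono card_image_le) auto
  also have "\<dots> \<le> 1 + r + s ^ s * s ^ s"
    using R1_card mult_le_mono[OF R_card R_card] by (simp add: card_cartesian_product)
  finally have card_\<N>: "card \<N> \<le> 1 + r + s ^ s * s ^ s" .
  have "N \<lhd> G \<and> finite N \<and> card N \<le> order_bound n" if "N \<in> \<N>" for N
  proof -
    consider "N = N1" | d where "d \<in> R1" "N = N2 d" | p q where "p \<in> R" "q \<in> R" "N = N3 (comm p q)"
      using \<open>N \<in> \<N>\<close> unfolding \<N>_def by auto
    then show ?thesis
    proof cases
      case 2
      then show ?thesis using N2 R1(1) by blast
    next
      case 3
      then have "is_commutator G (comm p q)" using R(1) is_commutator_comm by blast
      then show ?thesis using N3 "3"(3) by blast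
    qed (use N1 in simp)
  qed
  then obtain M where M: "M \<lhd> G" "finite M" "card M \<le> order_bound n ^ card \<N>" "\<forall>N\<in>\<N>. N \<subseteq> M"
    using ex_normal_containing[OF fin] by blast
  note Znormal = centralizer_mod_normal[OF M(1)]
  note Zsub = normal_imp_subgroup[OF Znormal]
  note Zclosed = subgroup.m_closed[OF Zsub] subgroup.m_inv_closed[OF Zsub] normal_conj_by[OF Znormal]
  have toM: "x \<in> centralizer_mod M" if "x \<in> centralizer_mod N" "N \<in> \<N>" for x N
    using that M(4) centralizer_mod_mono by blast
  \<comment> \<open>With \<open>g = t u\<close>, \<open>[g, v] = [t, v]^u [u, v]\<close>; the first
    factor is handled by \<open>N2 t\<close>, the second by \<open>N1\<close>.\<close>
  have gv: "comm g v \<in> centralizer_mod M" if g: "g \<in> carrier G" and v: "v \<in> fixer S" for g v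
  proof -
    obtain t u where t: "t \<in> R1" "u \<in> fixer S1" "g = t \<otimes> u" using R1(4) g by blast
    have "fixer S \<subseteq> fixer S1" "fixer S \<subseteq> fixer (S2 t)"
      using t(1) by (auto intro!: fixer_antimono simp: S_def)
    with v have vf: "v \<in> fixer S1" "v \<in> fixer (S2 t)" by auto
    have c: "t \<in> carrier G" "u \<in> carrier G" "v \<in> carrier G"
      using t R1(1) v fixer_closed by auto
    have "comm t v \<in> centralizer_mod (N2 t)" using N2[OF c(1)] vf(2) by blast
    then have "comm t v \<in> centralizer_mod M" using t(1) by (intro toM) (auto simp: \<N>_def)
    moreover have "comm u v \<in> centralizer_mod N1" using Z1 t(2) vf(1) by blast
    then have "comm u v \<in> centralizer_mod M" by (rule toM) (simp add: \<N>_def)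
    ultimately show ?thesis using c Zclosed by (simp add: t(3) comm_mult_left)
  qed
  \<comment> \<open>With \<open>g = p u\<close> and \<open>h = q v\<close>, expansion leaves
    \<open>[p, q]\<close>, \<open>[u, q] = [q, u]^-1\<close> and \<open>[g, v]\<close>. The last two
    are covered by \<open>gv\<close>, and the first by \<open>N3\<close>.\<close>
  have "commutators \<subseteq> centralizer_mod M"
  proof
    fix x assume "x \<in> commutators"
    then obtain g h where gh: "g \<in> carrier G" "h \<in> carrier G" "x = comm g h"
      by (auto simp: commutators_eq)
    obtain p u where p: "p \<in> R" "u \<in> fixer S" "g = p \<otimes> u" using R(4) gh by blast
    obtain q v where q: "q \<in> R" "v \<in> fixer S" "h = q \<otimes> v" using R(4) gh by blast
    have c: "p \<in> carrier G" "u \<in> carrier G" "q \<in> carrier G" "v \<in> carrier G"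
      using p q R(1) fixer_closed by auto
    have "comm p q \<in> centralizer_mod (N3 (comm p q))" using N3 is_commutator_comm c by blast
    then have "comm p q \<in> centralizer_mod M" by (rule toM) (use p q in \<open>auto simp: \<N>_def\<close>)
    moreover have "comm u q \<in> centralizer_mod M"
      using Zclosed(2)[OF gv[OF c(3) p(2)]] c by (simp add: comm_inv)
    ultimately have "comm g q \<in> centralizer_mod M"
      using c Zclosed by (simp add: p(3) comm_mult_left)
    moreover have "comm g v \<in> centralizer_mod M" by (rule gv[OF gh(1) q(2)])
    ultimately show "x \<in> centralizer_mod M"
      using c gh Zclosed by (simp add: gh(3) q(3) comm_mult_right del: gh)
  qed
  then have "H \<subseteq> centralizer_mod M"
    unfolding H_eq by (rule generate_subgroup_incl[OF _ Zsub])
  then have sub: "second_derived G \<subseteq> M"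
    unfolding second_derived_def derived_subset_iff[OF H_subgroup normal_imp_subgroup[OF M(1)]]
    by (auto simp: centralizer_mod_def)
  show "finite (second_derived G)" using sub M(2) by (rule finite_subset)
  have "card (second_derived G) \<le> card M" using card_mono[OF M(2) sub] .
  also have "\<dots> \<le> order_bound n ^ card \<N>" by (rule M(3))
  also have "\<dots> \<le> order_bound n ^ (1 + r + s ^ s * s ^ s)"
    using card_\<N> order_bound_ge_1 by (rule power_increasing)
  also have "\<dots> = second_derived_bound n"
    by (simp add: second_derived_bound_def Let_def m_def r_def s_def)
  finally show "card (second_derived G) \<le> second_derived_bound n" .
qed

end

lemma bounds_second_derived_bound: "bounds_second_derived TYPE('a) second_derived_bound"
  unfolding bounds_second_derived_def
proof (intro allI impI)
  fix n :: nat and G :: "'a monoid"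
  assume "group G" "\<forall>x. is_commutator G x \<longrightarrow> finite (conj_class G x) \<and> card (conj_class G x) \<le> n"
  then interpret bounded_commutator_classes G n
    by (intro bounded_commutator_classes.intro bounded_commutator_classes_axioms.intro) auto
  show "finite (second_derived G) \<and> card (second_derived G) \<le> second_derived_bound n"
    using second_derived_bounded by blast
qed

context group
begin

subsection \<open>Passage to countable subgroups\<close>

text \<open>Supports of two factors are joined by union, using monotonicity of \<open>E\<close>. The
  family \<open>E\<close> is left abstract so that the argument can be repeated for derived
  groups.\<close>

lemma generate_finite_support:
  assumes E: "\<And>T T'. T \<subseteq> T' \<Longrightarrow> E T \<subseteq> E T'" "\<And>T. T \<subseteq> carrier G \<Longrightarrow> subgroup (E T) G"
    and A: "\<And>a. a \<in> A \<Longrightarrow> \<exists>T. finite T \<and> T \<subseteq> carrier G \<and> a \<in> E T"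
    and x: "x \<in> generate G A"
  shows "\<exists>T. finite T \<and> T \<subseteq> carrier G \<and> x \<in> E T"
  using x
proof (induction rule: generate.induct)
  case one
  show ?case using subgroup.one_closed[OF E(2)[of "{}"]] by (intro exI[of _ "{}"]) simp
next
  case (incl h)
  then show ?case by (rule A)
next
  case (inv h)
  then obtain T where "finite T" "T \<subseteq> carrier G" "h \<in> E T" using A by blast
  then show ?case using subgroup.m_inv_closed[OF E(2)] by blast
next
  case (eng x y)
  then obtain T T' where T: "finite T" "T \<subseteq> carrier G" "x \<in> E T" "finite T'" "T' \<subseteq> carrier G" "y \<in> E T'"
    by blast
  then have "x \<in> E (T \<union> T')" "y \<in> E (T \<union> T')" using E(1)[of T "T \<union> T'"] E(1)[of T' "T \<union> T'"] by auto
  then have "x \<otimes> y \<in> E (T \<union> T')" using T by (intro subgroup.m_closed[OF E(2)]) auto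
  with T show ?case by (intro exI[of _ "T \<union> T'"]) auto
qed

text \<open>The conclusion has the form of the hypothesis on \<open>A\<close>, with \<open>E\<close>
  replaced by its derived groups; applying the lemma twice reaches the second derived group.\<close>

lemma derived_finite_support:
  assumes E: "\<And>T T'. T \<subseteq> T' \<Longrightarrow> E T \<subseteq> E T'" "\<And>T. T \<subseteq> carrier G \<Longrightarrow> subgroup (E T) G"
    and A: "\<And>a. a \<in> A \<Longrightarrow> \<exists>T. finite T \<and> T \<subseteq> carrier G \<and> a \<in> E T"
    and x: "x \<in> derived G A"
  shows "\<exists>T. finite T \<and> T \<subseteq> carrier G \<and> x \<in> derived G (E T)"
proof (rule generate_finite_support[where E = "\<lambda>T. derived G (E T)"])
  show "derived G (E T) \<subseteq> derived G (E T')" if "T \<subseteq> T'" for T T'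
    using E(1)[OF that] by (rule mono_derived)
  show "subgroup (derived G (E T)) G" if "T \<subseteq> carrier G" for T
    using E(2)[OF that] by (intro derived_is_subgroup subgroup.subset)
  show "x \<in> generate G (derived_set G A)" using x by (simp add: derived_def)
  fix z assume "z \<in> derived_set G A"
  then obtain a b where z: "a \<in> A" "b \<in> A" "z = a \<otimes> b \<otimes> inv a \<otimes> inv b" by auto
  then obtain T T' where T: "finite T" "T \<subseteq> carrier G" "a \<in> E T" "finite T'" "T' \<subseteq> carrier G" "b \<in> E T'"
    using A by meson
  then have "a \<in> E (T \<union> T')" "b \<in> E (T \<union> T')" using E(1)[of T "T \<union> T'"] E(1)[of T' "T \<union> T'"] by auto
  then have "z \<in> derived G (E (T \<union> T'))"
    unfolding derived_def z(3) by (blast intro: generate.incl)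
  with T show "\<exists>T. finite T \<and> T \<subseteq> carrier G \<and> z \<in> derived G (E T)"
    by (intro exI[of _ "T \<union> T'"]) auto
qed

lemma second_derived_finite_support:
  assumes "finite F" "F \<subseteq> second_derived G"
  shows "\<exists>T. finite T \<and> T \<subseteq> carrier G \<and> F \<subseteq> derived G (derived G (generate G T))"
proof -
  have "\<exists>T. finite T \<and> T \<subseteq> carrier G \<and> x \<in> derived G (derived G (generate G T))"
    if "x \<in> second_derived G" for x
  proof (rule derived_finite_support[where E = "\<lambda>T. derived G (generate G T)"])
    show "x \<in> derived G (derived G (carrier G))" using that by (simp add: second_derived_def)
    show "subgroup (derived G (generate G T)) G" if "T \<subseteq> carrier G" for T
      using that by (intro derived_is_subgroup generate_incl)
    show "\<exists>T. finite T \<and> T \<subseteq> carrier G \<and> y \<in> derived G (generate G T)"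
      if y: "y \<in> derived G (carrier G)" for y
    proof (rule derived_finite_support[OF _ _ _ y])
      show "\<exists>T. finite T \<and> T \<subseteq> carrier G \<and> a \<in> generate G T" if "a \<in> carrier G" for a
        using that by (intro exI[of _ "{a}"]) (auto intro: generate.incl)
    qed (simp_all add: mono_generate generate_is_subgroup)
  qed (auto intro!: mono_derived mono_generate)
  then obtain T where T: "\<And>x. x \<in> F \<Longrightarrow> finite (T x) \<and> T x \<subseteq> carrier G \<and> x \<in> derived G (derived G (generate G (T x)))"
    using assms(2) by (metis subsetD)
  show ?thesis
  proof (intro exI[of _ "\<Union>(T ` F)"] conjI subsetI)
    fix x assume x: "x \<in> F"
    have "derived G (derived G (generate G (T x))) \<subseteq> derived G (derived G (generate G (\<Union>(T ` F))))"
      using x by (intro mono_derived mono_generate) blast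
    with T[OF x] show "x \<in> derived G (derived G (generate G (\<Union>(T ` F))))" by blast
  qed (use T assms(1) in auto)
qed

lemma countable_generate:
  assumes "countable T" "T \<subseteq> carrier G"
  shows "countable (generate G T)"
proof -
  define S where "S = T \<union> m_inv G ` T"
  have "generate G T \<subseteq> generate G S" by (rule mono_generate) (simp add: S_def)
  also have "\<dots> \<subseteq> word ` lists S" using assms(2) by (intro generate_subset_words) (auto simp: S_def)
  finally show ?thesis by (rule countable_subset) (simp add: S_def assms(1))
qed

end

section \<open>Transfer from groups of natural numbers to groups over any type\<close>

lemma group_hom_second_derived:
  assumes "group_hom K G h"
  shows "derived G (derived G (h ` carrier K)) = h ` second_derived K"
proof -
  interpret group_hom K G h by (rule assms)
  show ?thesis
    using derived_img[OF order_refl] derived_img[OF G.derived_in_carrier[OF order_refl]]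
    by (simp add: second_derived_def)
qed

lemma conj_class_img:
  assumes "group_hom K G h" "x \<in> carrier K"
  shows "h ` conj_class K x \<subseteq> conj_class G (h x)"
proof -
  interpret group_hom K G h by (rule assms)
  show ?thesis using assms(2) by (auto simp: conj_class_def)
qed

lemma is_commutator_img:
  assumes "group_hom K G h" "is_commutator K x"
  shows "is_commutator G (h x)"
proof -
  interpret group_hom K G h by (rule assms)
  obtain a b where "a \<in> carrier K" "b \<in> carrier K" "x = group_commutator K a b"
    using assms(2) by (auto simp: is_commutator_def)
  then show ?thesis
    unfolding is_commutator_def by (intro bexI[of _ "h a"] bexI[of _ "h b"]) (auto simp: group_commutator_def)
qed

text \<open>The group structure of \<open>K\<close> is transported along an injection into the
  natural numbers; \<open>h\<close> is the inverse of that injection on its image.\<close>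

lemma ex_countable_copy:
  fixes G :: "('a, 'b) monoid_scheme" (structure)
  assumes "group G" "subgroup K G" "countable K"
  shows "\<exists>(L :: nat monoid) h. group_hom L G h \<and> inj_on h (carrier L) \<and> h ` carrier L = K"
proof -
  interpret group G by (rule assms)
  note closed = subgroup.one_closed[OF assms(2)] subgroup.m_closed[OF assms(2)]
    subgroup.m_inv_closed[OF assms(2)]
  note mem = subgroup.mem_carrier[OF assms(2)]
  obtain \<phi> :: "'a \<Rightarrow> nat" where inj: "inj_on \<phi> K"
    using assms(3) by (auto simp: countable_def)
  define \<psi> where "\<psi> = inv_into K \<phi>"
  have [simp]: "\<psi> (\<phi> x) = x" if "x \<in> K" for x using inj that by (simp add: \<psi>_def)
  define L where "L = \<lparr>carrier = \<phi> ` K, mult = \<lambda>a b. \<phi> (\<psi> a \<otimes> \<psi> b), one = \<phi> \<one>\<rparr>"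
  have "group L"
  proof (rule groupI)
    fix x assume "x \<in> carrier L"
    then obtain a where "a \<in> K" "x = \<phi> a" by (auto simp: L_def)
    then show "\<exists>y\<in>carrier L. y \<otimes>\<^bsub>L\<^esub> x = \<one>\<^bsub>L\<^esub>"
      using closed mem by (intro bexI[of _ "\<phi> (inv a)"]) (auto simp: L_def)
  qed (use closed mem in \<open>auto simp: L_def m_assoc\<close>)
  moreover have "\<psi> \<in> hom L G" using closed mem by (auto simp: hom_def L_def)
  ultimately have "group_hom L G \<psi>"
    by (simp add: group_hom_def group_hom_axioms_def is_group)
  moreover have "inj_on \<psi> (carrier L)" by (auto simp: L_def inj_on_def)
  moreover have "\<psi> ` carrier L = K" by (force simp: L_def)
  ultimately show ?thesis by blast
qed

text \<open>It suffices to bound every finite subset of the second derived group by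
  \<open>f n\<close>, which also yields finiteness. The class bound passes to the countable copy
  because \<open>h\<close> is injective and maps conjugacy classes into conjugacy classes.\<close>

lemma bounds_second_derived_transfer:
  assumes f: "bounds_second_derived TYPE(nat) f"
  shows "bounds_second_derived TYPE('a) f"
  unfolding bounds_second_derived_def
proof (intro allI impI)
  fix n :: nat and G :: "'a monoid"
  assume n: "0 < n" and "group G"
    and X: "\<forall>x. is_commutator G x \<longrightarrow> finite (conj_class G x) \<and> card (conj_class G x) \<le> n"
  interpret group G by (rule \<open>group G\<close>)
  show "finite (second_derived G) \<and> card (second_derived G) \<le> f n"
  proof (rule finite_if_finite_subsets_card_bdd)
    fix F assume "F \<subseteq> second_derived G" "finite F"
    then obtain T where T: "finite T" "T \<subseteq> carrier G" "F \<subseteq> derived G (derived G (generate G T))"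
      using second_derived_finite_support[of F] by auto
    obtain L :: "nat monoid" and h where L: "group_hom L G h" "inj_on h (carrier L)"
      "h ` carrier L = generate G T"
      using ex_countable_copy[OF \<open>group G\<close> generate_is_subgroup[OF T(2)]]
        countable_generate[OF countable_finite[OF T(1)] T(2)] by blast
    interpret L: group_hom L G h by (rule L(1))
    have "finite (conj_class L x) \<and> card (conj_class L x) \<le> n" if x: "is_commutator L x" for x
    proof -
      have xc: "x \<in> carrier L" using x by (auto simp: is_commutator_def group_commutator_def)
      have inj: "inj_on h (conj_class L x)"
        using L(2) L.G.conj_class_closed[OF xc] by (rule inj_on_subset)
      note sub = conj_class_img[OF L(1) xc]
      have G: "finite (conj_class G (h x))" "card (conj_class G (h x)) \<le> n"
        using X is_commutator_img[OF L(1) x] by auto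
      show ?thesis
        using inj_on_finite[OF inj sub G(1)] card_inj_on_le[OF inj sub G(1)] G(2) by simp
    qed
    then have sd: "finite (second_derived L)" "card (second_derived L) \<le> f n"
      using f[unfolded bounds_second_derived_def, rule_format, OF n L.G.is_group] by simp_all
    have "F \<subseteq> h ` second_derived L"
      using T(3) group_hom_second_derived[OF L(1)] unfolding L(3) by simp
    then show "card F \<le> f n" using surj_card_le[OF sd(1)] sd(2) by (meson order_trans)
  qed
qed

theorem theorem1p1:
  shows "(\<exists>f :: nat \<Rightarrow> nat. (\<forall>n > 0. f n > 0) \<and> bounds_second_derived TYPE(nat) f) \<and>
         (\<forall>f :: nat \<Rightarrow> nat. (\<forall>n > 0. f n > 0) \<and> bounds_second_derived TYPE(nat) f \<longrightarrow>
            bounds_second_derived TYPE('a) f)"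
proof (intro conjI allI impI)
  have "0 < second_derived_bound n" for n
    using order_bound_ge_1[of n] by (simp add: second_derived_bound_def Let_def)
  then show "\<exists>f :: nat \<Rightarrow> nat. (\<forall>n > 0. f n > 0) \<and> bounds_second_derived TYPE(nat) f"
    using bounds_second_derived_bound by (intro exI[of _ second_derived_bound]) simp
  show "bounds_second_derived TYPE('a) f"
    if "(\<forall>n > 0. f n > 0) \<and> bounds_second_derived TYPE(nat) f" for f
    by (rule bounds_second_derived_transfer[OF conjunct2[OF that]])
qed

end
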